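(* Let $\|\cdot\|$ be a norm on $\mathbb{R}^2$ and let $V\subset\mathbb{R}^2$ consist of $n$ vectors with $\|v\|=1$ for every $v\in V$. Then there is an ordering $w_1,\dots,w_n$ of $V$, together with signs $\varepsilon_i\in\{-1,+1\}$ $(i=1,\dots,n)$, such that $\left\|\sum_{i=1}^k\varepsilon_iw_i\right\|\le 1$ for every odd $k\in\{1,\dots,n\}$. *)

theory Defs
  imports "HOL-Analysis.Analysis"
begin

(* An arbitrary norm is an explicit function here, since the type-class norm on
   real ^ 2 is the Euclidean one. *)
definition is_norm :: "('a::real_vector \<Rightarrow> real) \<Rightarrow> bool" where
  "is_norm N \<longleftrightarrow>
     (\<forall>x. 0 \<le> N x) \<and>
     (\<forall>x. N x = 0 \<longleftrightarrow> x = 0) \<and>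
     (\<forall>c x. N (c *\<^sub>R x) = \<bar>c\<bar> * N x) \<and>
     (\<forall>x y. N (x + y) \<le> N x + N y)"

end

theory Submission
  imports Defs
begin

text \<open>
  Flip the vectors into an open half-plane, sort them by slope and let the signs alternate; every
  odd prefix is then an alternating sum \<open>s\<close> of unit vectors \<open>u 1, \<dots>, u k\<close> in angular order. To see
  that \<open>s\<close> has norm at most 1, test against a linear functional \<open>f\<close> bounded by the norm. Up to
  replacing \<open>f\<close> by \<open>-f\<close>, let \<open>\<bar>f (u i)\<bar>\<close> be maximal at \<open>i = m\<close> with \<open>f (u m) \<ge> 0\<close>. Along the half of
  the unit circle from \<open>u 1\<close> to \<open>-u 1\<close>, the values of \<open>f\<close> increase up to \<open>u m\<close> and decrease afterwards,
  so their total variation is \<open>2 * f (u m)\<close>. As \<open>k\<close> is odd, \<open>2 * f s\<close> is a signed sum of the increments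
  of \<open>f\<close> along the closed-up sequence \<open>u 1, \<dots>, u k, -u 1\<close>, whence \<open>\<bar>f s\<bar> \<le> f (u m)\<close>.
\<close>

text \<open>Summation by parts: each interior \<open>g i\<close> occurs in two neighbouring
  increments, both times with sign \<open>(-1)^(i+1)\<close>, while the two end values occur only
  once.\<close>

lemma sum_alternating_increments:
  fixes g :: "nat \<Rightarrow> real"
  assumes "1 \<le> k"
  shows "(\<Sum>i=1..<k. (-1)^(i+1) * (g i - g (Suc i)))
           = 2 * (\<Sum>i=1..k. (-1)^(i+1) * g i) - g 1 + (-1)^k * g k"
  using assms by (induction k rule: dec_induct) (auto simp: algebra_simps)

lemma alternating_sum_unimodal_le:
  fixes g :: "nat \<Rightarrow> real"
  assumes "odd k" "m \<in> {1..k}"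
    and inc: "\<And>i. 1 \<le> i \<Longrightarrow> i < m \<Longrightarrow> g i \<le> g (Suc i)"
    and dec: "\<And>i. m \<le> i \<Longrightarrow> i < k \<Longrightarrow> g (Suc i) \<le> g i"
    and ends: "0 \<le> g 1 + g k"
  shows "\<bar>\<Sum>i=1..k. (-1)^(i+1) * g i\<bar> \<le> g m"
proof -
  let ?s = "\<Sum>i=1..k. (-1)^(i+1) * g i"
  let ?d = "\<Sum>i=1..<k. (-1)^(i+1) * (g i - g (Suc i))"
  have m: "1 \<le> m" "m \<le> k" using assms(2) by auto
  have "\<bar>?d\<bar> \<le> (\<Sum>i=1..<k. \<bar>(-1)^(i+1) * (g i - g (Suc i))\<bar>)"
    by (rule sum_abs)
  also have "\<dots> = (\<Sum>i=1..<k. \<bar>g i - g (Suc i)\<bar>)"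
    by (simp add: abs_mult power_abs)
  also have "\<dots> = (\<Sum>i=1..<m. \<bar>g i - g (Suc i)\<bar>) + (\<Sum>i=m..<k. \<bar>g i - g (Suc i)\<bar>)"
    using m by (simp add: sum.atLeastLessThan_concat)
  also have "(\<Sum>i=1..<m. \<bar>g i - g (Suc i)\<bar>) = (\<Sum>i=1..<m. g (Suc i) - g i)"
    using inc by (intro sum.cong) auto
  also have "\<dots> = g m - g 1"
    using m by (intro sum_Suc_diff')
  also have "(\<Sum>i=m..<k. \<bar>g i - g (Suc i)\<bar>) = - (\<Sum>i=m..<k. g (Suc i) - g i)"
    unfolding sum_negf[symmetric] using dec by (intro sum.cong) auto
  also have "(\<Sum>i=m..<k. g (Suc i) - g i) = g k - g m"
    using m by (intro sum_Suc_diff')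
  finally have "\<bar>?d\<bar> \<le> 2 * g m - g 1 - g k" by simp
  moreover have "?d = 2 * ?s - g 1 - g k"
    using sum_alternating_increments[of k g] m \<open>odd k\<close> by simp
  \<comment> \<open>The upper bound on \<open>?s\<close> is immediate. The lower one reads
    \<open>- ?s \<le> g m - (g 1 + g k)\<close>, and here \<open>ends\<close> enters: the closing
    increment from \<open>g k\<close> to \<open>- g 1\<close> is also a descent.\<close>
  ultimately show ?thesis using ends by (simp add: abs_le_iff)
qed

lemma is_norm_minus:
  assumes "is_norm N" shows "N (- x) = N x"
proof -
  have "N ((-1) *\<^sub>R x) = \<bar>-1\<bar> * N x" using assms unfolding is_norm_def by blast
  then show ?thesis by simp
qed

lemma is_norm_support_functional:
  fixes N :: "'a::euclidean_space \<Rightarrow> real"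
  assumes N: "is_norm N" and x: "1 < N x"
  shows "\<exists>a b. 0 < b \<and> (\<forall>y. N y = 1 \<longrightarrow> \<bar>a \<bullet> y\<bar> \<le> b) \<and> b < a \<bullet> x"
proof -
  have nn: "0 \<le> N y" and eq0: "N y = 0 \<longleftrightarrow> y = 0" and sc: "N (c *\<^sub>R y) = \<bar>c\<bar> * N y"
    and tri: "N (y + z) \<le> N y + N z" for c y z
    using N by (auto simp: is_norm_def)
  \<comment> \<open>Separation yields only weak inequalities. So the unit ball is separated from
    \<open>x\<close> shrunk by \<open>c\<close>, which is still outside; scaling back by
    \<open>c\<close> makes the last inequality strict.\<close>
  obtain c where c: "1 < c" "c < N x" using x dense by blast
  let ?S = "{y. N y \<le> 1}"
  have "convex ?S"
  proof (rule convexI)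
    fix y z :: 'a and s t :: real
    assume *: "y \<in> ?S" "z \<in> ?S" "0 \<le> s" "0 \<le> t" "s + t = 1"
    have "N (s *\<^sub>R y + t *\<^sub>R z) \<le> s * N y + t * N z"
      using tri[of "s *\<^sub>R y" "t *\<^sub>R z"] * by (simp add: sc)
    also have "\<dots> \<le> 1" using * by (auto intro: convex_bound_le)
    finally show "s *\<^sub>R y + t *\<^sub>R z \<in> ?S" by simp
  qed
  moreover have "?S \<noteq> {}" using eq0[of 0] by (auto intro: exI[of _ 0])
  moreover have "?S \<inter> {(1/c) *\<^sub>R x} = {}"
    using c by (auto simp: sc)
  ultimately obtain a b where a: "a \<noteq> 0" "\<forall>y\<in>?S. a \<bullet> y \<le> b" "b \<le> a \<bullet> ((1/c) *\<^sub>R x)"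
    using separating_hyperplane_sets[of ?S "{(1/c) *\<^sub>R x}"] by auto
  \<comment> \<open>The ball contains a positive multiple of \<open>a\<close>, which forces
    \<open>b\<close> to be positive.\<close>
  have Na: "0 < N a" using nn[of a] eq0[of a] a(1) by linarith
  have "a \<bullet> ((1 / N a) *\<^sub>R a) \<le> b"
    using Na by (intro a(2)[rule_format]) (simp add: sc)
  moreover have "0 < a \<bullet> ((1 / N a) *\<^sub>R a)"
    using Na a(1) by simp
  ultimately have b: "0 < b" by linarith
  have "b < c * b" using b c by simp
  also have "\<dots> \<le> a \<bullet> x" using a(3) c by (simp add: field_simps)
  finally have "b < a \<bullet> x" .
  moreover have "\<bar>a \<bullet> y\<bar> \<le> b" if "N y = 1" for y
    using a(2)[rule_format, of y] a(2)[rule_format, of "-y"] is_norm_minus[OF N, of y] that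
    by (simp add: abs_le_iff)
  ultimately show ?thesis using b by blast
qed

text \<open>Angular betweenness without angles. The end vectors may coincide, so repeated indices
  need no special treatment.\<close>

definition in_cone :: "'a::real_vector \<Rightarrow> 'a \<Rightarrow> 'a \<Rightarrow> bool" where
  "in_cone u w v \<longleftrightarrow> (\<exists>\<alpha> \<beta>. 0 \<le> \<alpha> \<and> 0 \<le> \<beta> \<and> v = \<alpha> *\<^sub>R u + \<beta> *\<^sub>R w)"

lemma in_cone_commute: "in_cone u w v \<longleftrightarrow> in_cone w u v"
  unfolding in_cone_def by (metis add.commute)

text \<open>These are the three triangle inequalities for the triangle with sides \<alpha> u,
  \<beta> w and v, whose lengths are \<alpha>, \<beta> and 1.\<close>

lemma in_cone_unit_coeffs:
  assumes N: "is_norm N" and unit: "N u = 1" "N v = 1" "N w = 1" and "in_cone u w v"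
  obtains \<alpha> \<beta> where "0 \<le> \<alpha>" "0 \<le> \<beta>" "v = \<alpha> *\<^sub>R u + \<beta> *\<^sub>R w"
    "1 \<le> \<alpha> + \<beta>" "\<alpha> \<le> 1 + \<beta>" "\<beta> \<le> 1 + \<alpha>"
proof -
  have sc: "N (c *\<^sub>R y) = \<bar>c\<bar> * N y" and tri: "N (y + z) \<le> N y + N z" for c y z
    using N by (auto simp: is_norm_def)
  obtain \<alpha> \<beta> where ab: "0 \<le> \<alpha>" "0 \<le> \<beta>" "v = \<alpha> *\<^sub>R u + \<beta> *\<^sub>R w"
    using assms(5) unfolding in_cone_def by blast
  have "1 \<le> \<alpha> + \<beta>"
    using tri[of "\<alpha> *\<^sub>R u" "\<beta> *\<^sub>R w"] ab unit by (simp add: sc)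
  moreover have "\<alpha> \<le> 1 + \<beta>"
    using tri[of v "(-\<beta>) *\<^sub>R w"] ab unit sc[of \<alpha> u] sc[of "-\<beta>" w] by simp
  moreover have "\<beta> \<le> 1 + \<alpha>"
    using tri[of v "(-\<alpha>) *\<^sub>R u"] ab unit sc[of \<beta> w] sc[of "-\<alpha>" u] by simp
  ultimately show ?thesis using that ab by blast
qed

text \<open>Monotonicity of a functional along the arc leading away from its maximum
  \<open>u\<close>. Replacing \<open>a \<bullet> u\<close> by the smaller
  \<open>\<bar>a \<bullet> w\<bar>\<close> leaves a multiple of \<open>a \<bullet> w\<close>, with
  factor \<alpha> + \<beta> or \<beta> - \<alpha> according to its sign; comparing this factor with
  1 suffices.\<close>

lemma inner_le_in_cone:
  assumes "is_norm N" "N u = 1" "N v = 1" "N w = 1" "in_cone u w v"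
    and dom: "\<bar>a \<bullet> w\<bar> \<le> a \<bullet> u"
  shows "a \<bullet> w \<le> a \<bullet> v"
proof -
  obtain \<alpha> \<beta> where ab: "0 \<le> \<alpha>" "0 \<le> \<beta>" "v = \<alpha> *\<^sub>R u + \<beta> *\<^sub>R w"
    "1 \<le> \<alpha> + \<beta>" "\<beta> \<le> 1 + \<alpha>"
    using in_cone_unit_coeffs[OF assms(1-5)] by metis
  have "\<alpha> * \<bar>a \<bullet> w\<bar> \<le> \<alpha> * (a \<bullet> u)" using ab dom by (intro mult_left_mono)
  then have le: "\<alpha> * \<bar>a \<bullet> w\<bar> + \<beta> * (a \<bullet> w) \<le> a \<bullet> v"
    by (simp add: ab(3) inner_add_right)
  show ?thesis
  proof (cases "0 \<le> a \<bullet> w")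
    case True
    then show ?thesis
      using le mult_right_mono[OF ab(4) True] by (simp add: algebra_simps)
  next
    case False
    then show ?thesis
      using le mult_right_mono_neg[of "\<beta> - \<alpha>" 1 "a \<bullet> w"] ab(5) by (simp add: algebra_simps)
  qed
qed

text \<open>Supplies the closing descent from the last vector \<open>w\<close> to
  \<open>- u\<close>, the far end of the half circle.\<close>

lemma inner_ends_in_cone:
  assumes "is_norm N" "N u = 1" "N v = 1" "N w = 1" "in_cone u w v"
    and dom: "\<bar>a \<bullet> u\<bar> \<le> a \<bullet> v" "\<bar>a \<bullet> w\<bar> \<le> a \<bullet> v"
  shows "0 \<le> a \<bullet> u + a \<bullet> w"
proof (rule ccontr)
  assume neg: "\<not> 0 \<le> a \<bullet> u + a \<bullet> w"
  \<comment> \<open>By symmetry \<open>x\<close> is the larger end value. As x + y < 0, z is at most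
    (\<alpha> - \<beta>) x, hence at most x if x is nonnegative, whereas z \<ge> -y > x. If x is
    negative, so is y, and z cannot be positive.\<close>
  have *: False if ab: "0 \<le> \<alpha>" "0 \<le> \<beta>" "\<alpha> \<le> 1 + \<beta>"
    and eq: "z = \<alpha> * x + \<beta> * y" and z: "\<bar>x\<bar> \<le> z" "\<bar>y\<bar> \<le> z" and xy: "x + y < 0" "y \<le> x"
    for \<alpha> \<beta> x y z :: real
  proof -
    have zpos: "x < z" "0 < z" using z xy by linarith+
    have zle: "z \<le> (\<alpha> - \<beta>) * x"
      using mult_nonneg_nonpos[of \<beta> "x + y"] ab(2) xy eq by (simp add: algebra_simps)
    show False
    proof (cases "0 \<le> x")
      case True
      then show False using mult_right_mono[of "\<alpha> - \<beta>" 1 x] ab zle zpos by simp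
    next
      case False
      then have "\<alpha> * x \<le> 0" "\<beta> * y \<le> 0"
        using ab xy by (auto intro: mult_nonneg_nonpos)
      then show False using eq zpos by linarith
    qed
  qed
  obtain \<alpha> \<beta> where ab: "0 \<le> \<alpha>" "0 \<le> \<beta>" "v = \<alpha> *\<^sub>R u + \<beta> *\<^sub>R w"
    "\<alpha> \<le> 1 + \<beta>" "\<beta> \<le> 1 + \<alpha>"
    using in_cone_unit_coeffs[OF assms(1-5)] by metis
  have eq: "a \<bullet> v = \<alpha> * (a \<bullet> u) + \<beta> * (a \<bullet> w)"
    by (simp add: ab(3) inner_add_right)
  show False
  proof (cases "a \<bullet> w \<le> a \<bullet> u")
    case True
    then show False using *[of \<alpha> \<beta> "a \<bullet> v" "a \<bullet> u" "a \<bullet> w"] ab eq dom neg by linarith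
  next
    case False
    then show False using *[of \<beta> \<alpha> "a \<bullet> v" "a \<bullet> w" "a \<bullet> u"] ab eq dom neg by linarith
  qed
qed

lemma alternating_sum_angular_le_1:
  fixes N :: "'a::euclidean_space \<Rightarrow> real" and u :: "nat \<Rightarrow> 'a"
  assumes N: "is_norm N" and "odd k"
    and unit: "\<And>i. i \<in> {1..k} \<Longrightarrow> N (u i) = 1"
    and cone: "\<And>i j l. 1 \<le> i \<Longrightarrow> i \<le> j \<Longrightarrow> j \<le> l \<Longrightarrow> l \<le> k \<Longrightarrow> in_cone (u i) (u l) (u j)"
  shows "N (\<Sum>i=1..k. (-1)^(i+1) *\<^sub>R u i) \<le> 1"
proof (rule ccontr)
  let ?s = "\<Sum>i=1..k. (-1)^(i+1) *\<^sub>R u i"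
  assume "\<not> N ?s \<le> 1"
  then have "1 < N ?s" by simp
  from is_norm_support_functional[OF N this] obtain a0 b where b: "0 < b" "\<And>y. N y = 1 \<Longrightarrow> \<bar>a0 \<bullet> y\<bar> \<le> b" "b < a0 \<bullet> ?s"
    by blast
  have k: "1 \<le> k" using \<open>odd k\<close> by (cases k) auto
  let ?A = "(\<lambda>i. \<bar>a0 \<bullet> u i\<bar>) ` {1..k}"
  have "Max ?A \<in> ?A" using k by (intro Max_in) auto
  then obtain m where m: "m \<in> {1..k}" and "Max ?A = \<bar>a0 \<bullet> u m\<bar>" by blast
  then have max: "\<bar>a0 \<bullet> u i\<bar> \<le> \<bar>a0 \<bullet> u m\<bar>" if "i \<in> {1..k}" for i
    using Max_ge[of ?A "\<bar>a0 \<bullet> u i\<bar>"] that by simp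
  define a where "a = (if 0 \<le> a0 \<bullet> u m then a0 else - a0)"
  have abs_a: "\<bar>a \<bullet> y\<bar> = \<bar>a0 \<bullet> y\<bar>" for y by (simp add: a_def)
  have am: "\<bar>a \<bullet> u i\<bar> \<le> a \<bullet> u m" if "i \<in> {1..k}" for i
    using max[OF that] by (auto simp: a_def)
  have "\<bar>\<Sum>i=1..k. (-1)^(i+1) * (a \<bullet> u i)\<bar> \<le> a \<bullet> u m"
  proof (rule alternating_sum_unimodal_le[OF \<open>odd k\<close> m])
    fix i assume i: "1 \<le> i" "i < m"
    have "in_cone (u m) (u i) (u (Suc i))"
      \<comment> \<open>Before \<open>m\<close> the arc leads away from the maximum as the index
        falls, so the ends of the cone are swapped.\<close>
      using cone[of i "Suc i" m] i m by (simp add: in_cone_commute)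
    then show "a \<bullet> u i \<le> a \<bullet> u (Suc i)"
      using i m by (intro inner_le_in_cone[OF N, of "u m"] unit am) auto
  next
    fix i assume i: "m \<le> i" "i < k"
    have "in_cone (u m) (u (Suc i)) (u i)"
      using cone[of m i "Suc i"] i m by simp
    then show "a \<bullet> u (Suc i) \<le> a \<bullet> u i"
      using i m by (intro inner_le_in_cone[OF N, of "u m"] unit am) auto
  next
    show "0 \<le> a \<bullet> u 1 + a \<bullet> u k"
      using m cone[of 1 m k] by (intro inner_ends_in_cone[OF N, of _ "u m"] unit am) auto
  qed
  moreover have "(\<Sum>i=1..k. (-1)^(i+1) * (a \<bullet> u i)) = a \<bullet> ?s"
    by (simp add: inner_sum_right)
  moreover have "a \<bullet> u m \<le> b"
    using b(2)[OF unit[OF m]] abs_a[of "u m"] by linarith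
  ultimately show False using b(3) abs_a[of ?s] by linarith
qed

text \<open>Turns sorting by a real parameter into angular order: on the line
  \<open>c + \<kappa> *\<^sub>R d\<close> betweenness is convex combination, and positive factors
  are absorbed into the cone coefficients.\<close>

lemma in_cone_affine_slice:
  assumes "x1 = p1 *\<^sub>R (c + \<kappa>1 *\<^sub>R d)" "x2 = p2 *\<^sub>R (c + \<kappa>2 *\<^sub>R d)" "x3 = p3 *\<^sub>R (c + \<kappa>3 *\<^sub>R d)"
    and "0 < p1" "0 < p2" "0 < p3" and "\<kappa>1 \<le> \<kappa>2" "\<kappa>2 \<le> \<kappa>3"
  shows "in_cone x1 x3 x2"
proof -
  have "\<kappa>2 \<in> closed_segment \<kappa>1 \<kappa>3"
    using assms by (simp add: closed_segment_eq_real_ivl)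
  then obtain t where t: "0 \<le> t" "t \<le> 1" "\<kappa>2 = (1 - t) * \<kappa>1 + t * \<kappa>3"
    by (auto simp: closed_segment_def)
  have "x2 = (p2 * (1 - t) / p1) *\<^sub>R x1 + (p2 * t / p3) *\<^sub>R x3"
  proof -
    have "(p2 * (1 - t) / p1) *\<^sub>R x1 + (p2 * t / p3) *\<^sub>R x3
        = (p2 * (1 - t)) *\<^sub>R (c + \<kappa>1 *\<^sub>R d) + (p2 * t) *\<^sub>R (c + \<kappa>3 *\<^sub>R d)"
      using assms(4-6) by (simp add: assms(1,3))
    also have "\<dots> = x2"
      unfolding assms(2) t(3) by (simp add: algebra_simps)
    finally show ?thesis by simp
  qed
  moreover have "0 \<le> p2 * (1 - t) / p1" "0 \<le> p2 * t / p3"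
    using t assms(4-6) by simp_all
  ultimately show ?thesis unfolding in_cone_def by blast
qed

lemma finite_sorted_enumeration:
  fixes f :: "'a \<Rightarrow> 'b::linorder"
  assumes "finite A"
  obtains w where "bij_betw w {1..card A} A"
    "\<And>i j. 1 \<le> i \<Longrightarrow> i \<le> j \<Longrightarrow> j \<le> card A \<Longrightarrow> f (w i) \<le> f (w j)"
proof -
  obtain ys where ys: "set ys = A" "distinct ys"
    using finite_distinct_list[OF assms] by blast
  define xs where "xs = sort_key f ys"
  have xs: "set xs = A" "distinct xs" "sorted (map f xs)"
    using ys by (auto simp: xs_def)
  have len: "length xs = card A" using xs distinct_card by fastforce
  have "bij_betw (\<lambda>i. i - 1) {1..card A} {..<card A}"
    by (rule bij_betw_byWitness[where f' = Suc]) auto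
  moreover have "bij_betw (nth xs) {..<card A} A"
    by (rule bij_betw_nth) (simp_all only: xs(1,2) len)
  ultimately have "bij_betw (nth xs \<circ> (\<lambda>i. i - 1)) {1..card A} A"
    by (rule bij_betw_trans)
  moreover have "f ((nth xs \<circ> (\<lambda>i. i - 1)) i) \<le> f ((nth xs \<circ> (\<lambda>i. i - 1)) j)"
    if "1 \<le> i" "i \<le> j" "j \<le> card A" for i j
    using sorted_nth_mono[OF xs(3), of "i - 1" "j - 1"] that len by simp
  ultimately show ?thesis using that by blast
qed

theorem theorem3:
  fixes N :: "real ^ 2 \<Rightarrow> real" and V :: "(real ^ 2) set" and n :: nat
  assumes "is_norm N"
    and "finite V" and "card V = n"
    and "\<And>v. v \<in> V \<Longrightarrow> N v = 1"
  shows "\<exists>(w :: nat \<Rightarrow> real ^ 2) (\<epsilon> :: nat \<Rightarrow> real).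
           bij_betw w {1..n} V \<and>
           (\<forall>i\<in>{1..n}. \<epsilon> i \<in> {-1, 1}) \<and>
           (\<forall>k\<in>{1..n}. odd k \<longrightarrow> N (\<Sum>i=1..k. \<epsilon> i *\<^sub>R w i) \<le> 1)"
proof -
  note N = assms(1)
  have nz: "v \<noteq> 0" if "v \<in> V" for v
    using assms(4)[OF that] N unfolding is_norm_def by (metis zero_neq_one)
  \<comment> \<open>Each vector rules out at most one line \<open>p v = 0\<close> through the
    origin; when \<open>v $ 2 = 0\<close> the quotient is 0 by convention, and excluding that value
    is harmless.\<close>
  obtain t where t: "t \<notin> (\<lambda>v. - (v $ 1) / v $ 2) ` V"
    using ex_new_if_finite[OF infinite_UNIV_char_0 finite_imageI[OF assms(2)]] by metis
  define p where "p v = v $ 1 + t * v $ 2" for v :: "real ^ 2"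
  have p: "p v \<noteq> 0" if "v \<in> V" for v
  proof
    assume p0: "p v = 0"
    show False
    proof (cases "v $ 2 = 0")
      case True
      then show False using p0 nz[OF that] by (simp add: p_def vec_eq_iff forall_2)
    next
      case False
      then have "t = - (v $ 1) / v $ 2" using p0 by (simp add: p_def field_simps)
      then show False using t that by blast
    qed
  qed
  \<comment> \<open>This is the coordinate of \<open>v\<close> scaled onto the line p = 1. It is the
    same for \<open>v\<close> and \<open>- v\<close>, so sorting can precede the flip into the
    half-plane p > 0.\<close>
  define \<kappa> where "\<kappa> v = v $ 2 / p v" for v
  obtain w where w: "bij_betw w {1..n} V"
    "\<And>i j. 1 \<le> i \<Longrightarrow> i \<le> j \<Longrightarrow> j \<le> n \<Longrightarrow> \<kappa> (w i) \<le> \<kappa> (w j)"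
    using finite_sorted_enumeration[OF assms(2), of \<kappa>] assms(3) by metis
  have wV: "w i \<in> V" if "i \<in> {1..n}" for i using w(1) that bij_betwE by blast
  define u where "u i = sgn (p (w i)) *\<^sub>R w i" for i
  have slice: "u i = \<bar>p (w i)\<bar> *\<^sub>R (axis 1 1 + \<kappa> (w i) *\<^sub>R (axis 2 1 - t *\<^sub>R axis 1 1))"
    and pos: "0 < \<bar>p (w i)\<bar>" if "i \<in> {1..n}" for i
  proof -
    have "p (w i) \<noteq> 0" using p wV that by blast
    then show "0 < \<bar>p (w i)\<bar>" by simp
    have "w i = p (w i) *\<^sub>R (axis 1 1 + \<kappa> (w i) *\<^sub>R (axis 2 1 - t *\<^sub>R axis 1 1))"
      using \<open>p (w i) \<noteq> 0\<close>
      by (simp add: vec_eq_iff forall_2 axis_def \<kappa>_def field_simps) (simp add: p_def)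
    then have "u i = (sgn (p (w i)) * p (w i)) *\<^sub>R
        (axis 1 1 + \<kappa> (w i) *\<^sub>R (axis 2 1 - t *\<^sub>R axis 1 1))"
      unfolding u_def by (metis scaleR_scaleR)
    then show "u i = \<bar>p (w i)\<bar> *\<^sub>R (axis 1 1 + \<kappa> (w i) *\<^sub>R (axis 2 1 - t *\<^sub>R axis 1 1))"
      by (simp add: abs_sgn mult.commute)
  qed
  have unit: "N (u i) = 1" if "i \<in> {1..n}" for i
  proof -
    have "N (u i) = \<bar>sgn (p (w i))\<bar> * N (w i)"
      using N unfolding u_def is_norm_def by blast
    then show ?thesis using p[OF wV[OF that]] assms(4)[OF wV[OF that]] by (simp add: abs_sgn_eq)
  qed
  have cone: "in_cone (u i) (u l) (u j)" if "1 \<le> i" "i \<le> j" "j \<le> l" "l \<le> n" for i j l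
    using that by (intro in_cone_affine_slice[OF slice slice slice] pos w(2)) auto
  \<comment> \<open>Alternation combined with the flip. Nothing here depends on \<open>k\<close>, so
    one choice of signs serves all odd prefixes.\<close>
  define \<epsilon> where "\<epsilon> i = (-1)^(i+1) * sgn (p (w i))" for i
  have "\<epsilon> i \<in> {-1, 1}" if "i \<in> {1..n}" for i
    using p[OF wV[OF that]] by (cases "even i") (auto simp: \<epsilon>_def sgn_if)
  moreover have "N (\<Sum>i=1..k. \<epsilon> i *\<^sub>R w i) \<le> 1" if "k \<in> {1..n}" "odd k" for k
  proof -
    have "(\<Sum>i=1..k. \<epsilon> i *\<^sub>R w i) = (\<Sum>i=1..k. (-1)^(i+1) *\<^sub>R u i)"
      by (simp add: \<epsilon>_def u_def)
    also have "N \<dots> \<le> 1"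
      using that by (intro alternating_sum_angular_le_1[OF N] unit cone) auto
    finally show ?thesis .
  qed
  ultimately show ?thesis using w(1) by blast
qed

end
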